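(* Let $p$ and $q$ be distinct primes with $pq\neq 6$ and $q^2\mid p-1$. Let $r$ be an integer whose multiplicative order modulo $p^{2}$ is $q^{2}$, and let $G=\langle a,b\mid a^{q^{2}}=b^{p^{2}}=1,\ a^{-1}ba=b^{r}\rangle$. Then $\mathrm{Aut}(G)\simeq \mathbb{Z}_{p^{2}}\rtimes\mathbb{Z}_{p(p-1)}$.
   Context: $\mathbb{Z}_n$ is the cyclic group of order $n$. $X\rtimes Y$ denotes a semidirect product with normal subgroup $X$ with respect to some homomorphism $Y\to\mathrm{Aut}(X)$; the statement asserts that $\mathrm{Aut}(G)$ is isomorphic to such a semidirect product for some choice of action. *)

theory Defs
  imports "HOL-Algebra.Elementary_Groups" "HOL-Algebra.Bij" "HOL-Number_Theory.Number_Theory"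
begin

section \<open>Free groups\<close>

text \<open>A letter \<open>(x, True)\<close> is the generator \<open>x\<close>, and \<open>(x, False)\<close> is its formal inverse.\<close>

type_synonym 'a letter = "'a \<times> bool"

definition inv_letter :: "'a letter \<Rightarrow> 'a letter" where
  "inv_letter l = (fst l, \<not> snd l)"

definition reduced :: "'a letter list \<Rightarrow> bool" where
  "reduced w \<longleftrightarrow> successively (\<lambda>k l. l \<noteq> inv_letter k) w"

text \<open>\<open>push l w\<close> is the reduced form of \<open>l # w\<close>, for \<open>w\<close> reduced.\<close>

fun push :: "'a letter \<Rightarrow> 'a letter list \<Rightarrow> 'a letter list" where
  "push l [] = [l]"
| "push l (k # w) = (if k = inv_letter l then w else l # k # w)"

text \<open>The free group on \<open>S\<close>: reduced words, with concatenation followed by free reduction.\<close>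

definition free_group :: "'a set \<Rightarrow> 'a letter list monoid" where
  "free_group S =
     \<lparr>carrier = {w. reduced w \<and> fst ` set w \<subseteq> S},
      monoid.mult = (\<lambda>u v. foldr push u v),
      one = []\<rparr>"

definition free_gen :: "'a \<Rightarrow> 'a letter list" where
  "free_gen x = [(x, True)]"

lemma inv_letter_inv_letter [simp]: "inv_letter (inv_letter l) = l"
  by (simp add: inv_letter_def)

lemma fst_inv_letter [simp]: "fst (inv_letter l) = fst l"
  by (simp add: inv_letter_def)

lemma inv_letter_neq [simp]: "inv_letter l \<noteq> l"
  by (simp add: inv_letter_def prod_eq_iff)

lemma reduced_Nil [simp]: "reduced []"
  by (simp add: reduced_def)

lemma reduced_Cons:
  "reduced (l # w) \<longleftrightarrow> reduced w \<and> (w \<noteq> [] \<longrightarrow> hd w \<noteq> inv_letter l)"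
  by (cases w) (auto simp: reduced_def)

lemma reduced_push: "reduced w \<Longrightarrow> reduced (push l w)"
  by (cases w) (auto simp: reduced_Cons)

lemma push_push_inv: "reduced w \<Longrightarrow> push l (push (inv_letter l) w) = w"
proof (cases w)
  case (Cons k v)
  assume "reduced w"
  then show ?thesis using Cons by (cases v) (auto simp: reduced_Cons)
qed simp

lemma reduced_foldr_push: "reduced w \<Longrightarrow> reduced (foldr push u w)"
  by (induction u) (auto intro: reduced_push)

lemma foldr_push_push:
  assumes "reduced w"
  shows "foldr push (push l v) w = push l (foldr push v w)"
  using push_push_inv[OF reduced_foldr_push[OF assms]] by (cases v) auto

lemma foldr_push_assoc:
  "reduced w \<Longrightarrow> foldr push (foldr push u v) w = foldr push u (foldr push v w)"
  by (induction u) (auto simp: foldr_push_push)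

lemma foldr_push_Nil: "reduced u \<Longrightarrow> foldr push u [] = u"
proof (induction u)
  case (Cons l u)
  then show ?case by (cases u) (auto simp: reduced_Cons)
qed simp

lemma fst_set_push: "fst ` set (push l w) \<subseteq> insert (fst l) (fst ` set w)"
  by (cases w) auto

lemma fst_set_foldr_push: "fst ` set (foldr push u v) \<subseteq> fst ` set u \<union> fst ` set v"
proof (induction u)
  case (Cons l u)
  then show ?case using fst_set_push[of l "foldr push u v"]
    by (simp only: foldr.simps comp_apply list.set image_insert Un_insert_left) blast
qed simp

lemma foldr_push_inverse:
  assumes "reduced v"
  shows "foldr push (rev (map inv_letter u)) (foldr push u v) = v"
  using assms
proof (induction u arbitrary: v)
  case (Cons l u)
  have "push (inv_letter l) (push l (foldr push u v)) = foldr push u v"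
    using push_push_inv[OF reduced_foldr_push[OF Cons.prems], of "inv_letter l"] by simp
  then show ?case using Cons by simp
qed simp

theorem group_free_group: "group (free_group S)"
proof (rule groupI)
  fix u assume u: "u \<in> carrier (free_group S)"
  define v where "v = foldr push (rev (map inv_letter u)) []"
  have "fst ` set v \<subseteq> fst ` set u"
    using fst_set_foldr_push[of "rev (map inv_letter u)" "[]"]
    by (force simp: v_def image_image)
  then have "v \<in> carrier (free_group S)"
    using u by (auto simp: free_group_def v_def intro: reduced_foldr_push)
  moreover have "foldr push v u = []"
    using u foldr_push_inverse[of "[]" u]
    by (simp add: v_def free_group_def foldr_push_assoc foldr_push_Nil)
  ultimately show "\<exists>v\<in>carrier (free_group S). v \<otimes>\<^bsub>free_group S\<^esub> u = \<one>\<^bsub>free_group S\<^esub>"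
    by (auto simp: free_group_def)
next
  fix u v assume uv: "u \<in> carrier (free_group S)" "v \<in> carrier (free_group S)"
  have "fst ` set u \<union> fst ` set v \<subseteq> S" "reduced v"
    using uv by (simp_all add: free_group_def)
  then have "reduced (foldr push u v)" "fst ` set (foldr push u v) \<subseteq> S"
    using fst_set_foldr_push[of u v] by (blast intro: reduced_foldr_push subset_trans)+
  then show "u \<otimes>\<^bsub>free_group S\<^esub> v \<in> carrier (free_group S)"
    by (simp add: free_group_def)
qed (auto simp: free_group_def foldr_push_assoc)

section \<open>Presentations by generators and relators\<close>

definition normal_closure :: "('a, 'b) monoid_scheme \<Rightarrow> 'a set \<Rightarrow> 'a set" where
  "normal_closure G R = \<Inter>{N. N \<lhd> G \<and> R \<subseteq> N}"

definition presented_group :: "'a set \<Rightarrow> 'a letter list set \<Rightarrow> 'a letter list set monoid" where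
  "presented_group S R = free_group S Mod normal_closure (free_group S) R"

datatype gen = A | B

text \<open>
  The group \<open>\<langle>a, b | a^m = b^n = 1, a^-1 b a = b^r\<rangle>\<close>.  A relation \<open>u = v\<close> is encoded by the
  relator \<open>u v^-1\<close>; powers and inverses are taken in the free group.
\<close>

definition metacyclic_group :: "nat \<Rightarrow> nat \<Rightarrow> int \<Rightarrow> gen letter list set monoid" where
  "metacyclic_group m n r =
     (let F = free_group {A, B}; a = free_gen A; b = free_gen B in
      presented_group {A, B}
        {a [^]\<^bsub>F\<^esub> m,
         b [^]\<^bsub>F\<^esub> n,
         (inv\<^bsub>F\<^esub> a \<otimes>\<^bsub>F\<^esub> b \<otimes>\<^bsub>F\<^esub> a) \<otimes>\<^bsub>F\<^esub> inv\<^bsub>F\<^esub> (b [^]\<^bsub>F\<^esub> r)})"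

section \<open>Semidirect products\<close>

definition semidirect_product ::
  "('a, 'c) monoid_scheme \<Rightarrow> ('b, 'd) monoid_scheme \<Rightarrow> ('b \<Rightarrow> 'a \<Rightarrow> 'a) \<Rightarrow> ('a \<times> 'b) monoid" where
  "semidirect_product X Y \<phi> =
     \<lparr>carrier = carrier X \<times> carrier Y,
      monoid.mult = (\<lambda>(x, y) (x', y'). (x \<otimes>\<^bsub>X\<^esub> \<phi> y x', y \<otimes>\<^bsub>Y\<^esub> y')),
      one = (\<one>\<^bsub>X\<^esub>, \<one>\<^bsub>Y\<^esub>)\<rparr>"

end

theory Submission
  imports Defs
begin

text \<open>
  Write \<open>m = q^2\<close>, \<open>n = p^2\<close>.  An automorphism of \<open>G\<close> is an affine map: it sends \<open>b\<close> to \<open>b^u\<close> and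
  \<open>a\<close> to \<open>a b^c\<close>, with \<open>c\<close> and \<open>u\<close> taken modulo \<open>n\<close> and \<open>u\<close> a unit, and every such pair occurs.  The pairs compose by
  \<open>(c, u) (c', u') = (c + u c', u u')\<close>, so \<open>Aut G\<close> is the holomorph of \<open>Z_n\<close>, the semidirect product
  of \<open>Z_n\<close> with its unit group.  As \<open>p\<close> is odd, that unit group is cyclic of order \<open>p (p - 1)\<close>,
  and powers of a primitive root turn the pairs into elements of \<open>Z_n \<rtimes> Z_(p (p - 1))\<close>.

  There are two things to see.  First, which endomorphisms exist: by the universal property of the
  presentation it suffices that \<open>a b^c\<close> and \<open>b^u\<close> satisfy the defining relations
  (\<open>affine_relations\<close>).  Only \<open>(a b^c)^m = 1\<close> is not immediate.  It holds because \<open>r - 1\<close> is a unit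
  modulo \<open>n\<close>, which makes \<open>a b^c\<close> a conjugate of \<open>a\<close>.  The unit property comes from \<open>r\<close> having order
  \<open>q^2\<close>: were \<open>r\<close> congruent to 1 modulo \<open>p\<close>, its order modulo \<open>p^2\<close> would divide \<open>p\<close>
  (\<open>power_prime_cong_1\<close>).

  Second, why there are no other automorphisms (\<open>auto_affine\<close>): every element has the form
  \<open>a^i b^j\<close>, and \<open>i\<close> modulo \<open>m\<close> and \<open>j\<close> modulo \<open>n\<close> are determined by it
  (\<open>metacyclic_gen_independent\<close>, by mapping \<open>G\<close> to a concrete semidirect product).  The image of
  \<open>b\<close> is a power of \<open>b\<close> because \<open>m\<close> and \<open>n\<close> are coprime; comparing the images of both sides of
  \<open>b a = a b^r\<close> then gives \<open>r^i = r\<close> modulo \<open>n\<close> for the exponent \<open>i\<close> of \<open>a\<close> in the image of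
  \<open>a\<close>, so \<open>i\<close> is 1 modulo \<open>m\<close>, the order of \<open>r\<close>.
\<close>

section \<open>Homomorphisms out of presented groups\<close>

definition letter_value :: "('b, 'c) monoid_scheme \<Rightarrow> ('a \<Rightarrow> 'b) \<Rightarrow> 'a letter \<Rightarrow> 'b" where
  "letter_value H v l = (if snd l then v (fst l) else inv\<^bsub>H\<^esub> (v (fst l)))"

definition word_value :: "('b, 'c) monoid_scheme \<Rightarrow> ('a \<Rightarrow> 'b) \<Rightarrow> 'a letter list \<Rightarrow> 'b" where
  "word_value H v w = foldr (\<lambda>l. monoid.mult H (letter_value H v l)) w \<one>\<^bsub>H\<^esub>"

context group
begin

lemma letter_value_closed:
  "v \<in> S \<rightarrow> carrier G \<Longrightarrow> fst l \<in> S \<Longrightarrow> letter_value G v l \<in> carrier G"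
  by (auto simp: letter_value_def)

lemma word_value_closed:
  "v \<in> S \<rightarrow> carrier G \<Longrightarrow> fst ` set w \<subseteq> S \<Longrightarrow> word_value G v w \<in> carrier G"
  by (induction w) (auto simp: word_value_def letter_value_closed)

lemma letter_value_inv_letter:
  "v \<in> S \<rightarrow> carrier G \<Longrightarrow> fst l \<in> S \<Longrightarrow>
     letter_value G v (inv_letter l) = inv (letter_value G v l)"
  by (auto simp: letter_value_def inv_letter_def Pi_iff)

text \<open>
  Cancelling a letter against the head of the word is harmless because a letter and its formal inverse
  have mutually inverse values; this is the only place where free reduction matters.
\<close>

lemma word_value_push:
  assumes "v \<in> S \<rightarrow> carrier G" "fst l \<in> S" "fst ` set w \<subseteq> S"
  shows "word_value G v (push l w) = letter_value G v l \<otimes> word_value G v w"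
proof (cases w)
  case (Cons k u)
  have "letter_value G v l \<otimes> (inv (letter_value G v l) \<otimes> word_value G v u) = word_value G v u"
    using assms Cons letter_value_closed[OF assms(1,2)] word_value_closed[OF assms(1), of u]
    by (simp add: m_assoc[symmetric])
  with Cons assms show ?thesis
    by (auto simp: word_value_def letter_value_inv_letter)
qed (simp add: word_value_def)

lemma word_value_foldr_push:
  assumes "v \<in> S \<rightarrow> carrier G" "fst ` set u \<subseteq> S" "fst ` set w \<subseteq> S"
  shows "word_value G v (foldr push u w) = word_value G v u \<otimes> word_value G v w"
  using assms(2)
proof (induction u)
  case Nil
  then show ?case
    using word_value_closed[OF assms(1,3)] by (simp add: word_value_def)
next
  case (Cons l u)
  have "fst ` set (foldr push u w) \<subseteq> S"
    using fst_set_foldr_push[of u w] Cons.prems assms(3)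
    by (meson Un_least image_mono order_trans set_subset_Cons)
  then have "word_value G v (foldr push (l # u) w)
      = letter_value G v l \<otimes> word_value G v (foldr push u w)"
    using word_value_push[OF assms(1)] Cons.prems by simp
  also have "\<dots> = letter_value G v l \<otimes> (word_value G v u \<otimes> word_value G v w)"
    using Cons by simp
  also have "\<dots> = word_value G v (l # u) \<otimes> word_value G v w"
    using letter_value_closed[OF assms(1), of l] word_value_closed[OF assms(1), of u]
      word_value_closed[OF assms(1,3)] Cons.prems
    by (simp add: word_value_def m_assoc)
  finally show ?case .
qed

lemma word_value_hom:
  assumes "v \<in> S \<rightarrow> carrier G"
  shows "word_value G v \<in> hom (free_group S) G"
  using word_value_closed[OF assms] word_value_foldr_push[OF assms]
  by (auto intro!: homI simp: free_group_def)

lemma word_value_free_gen: "v x \<in> carrier G \<Longrightarrow> word_value G v (free_gen x) = v x"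
  by (simp add: word_value_def letter_value_def free_gen_def)

lemma normal_normal_closure:
  assumes "R \<subseteq> carrier G"
  shows "normal_closure G R \<lhd> G"
proof (rule normal_invI)
  have ne: "{N. N \<lhd> G \<and> R \<subseteq> N} \<noteq> {}"
    using normal_self assms by blast
  show "subgroup (normal_closure G R) G"
    unfolding normal_closure_def using ne
    by (intro subgroups_Inter) (auto intro: normal_imp_subgroup)
  show "x \<otimes> h \<otimes> inv x \<in> normal_closure G R"
    if "x \<in> carrier G" "h \<in> normal_closure G R" for x h
    using that by (auto simp: normal_closure_def intro: normal.inv_op_closed2)
qed

lemma normal_closure_superset: "R \<subseteq> normal_closure G R"
  by (auto simp: normal_closure_def)

end

lemma free_gen_closed: "x \<in> S \<Longrightarrow> free_gen x \<in> carrier (free_group S)"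
  by (simp add: free_gen_def free_group_def reduced_Cons)

lemma carrier_free_group:
  "carrier (free_group S) = generate (free_group S) (free_gen ` S)" (is "_ = ?gen")
proof
  interpret F: group "free_group S" by (rule group_free_group)
  have letter: "[l] \<in> ?gen" if "fst l \<in> S" for l
  proof (cases "snd l")
    case True
    then have "[l] = free_gen (fst l)" by (simp add: free_gen_def prod_eq_iff)
    then show ?thesis using that by (auto intro: generate.incl)
  next
    case False
    have "[l] \<in> carrier (free_group S)" "free_gen (fst l) \<in> carrier (free_group S)"
      using that by (auto simp: free_group_def reduced_Cons free_gen_def)
    moreover have "[l] \<otimes>\<^bsub>free_group S\<^esub> free_gen (fst l) = \<one>\<^bsub>free_group S\<^esub>"
      using False by (simp add: free_group_def free_gen_def inv_letter_def)
    ultimately have "[l] = inv\<^bsub>free_group S\<^esub> (free_gen (fst l))"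
      using F.inv_equality by metis
    then show ?thesis using that by (auto intro: generate.inv)
  qed
  have "reduced w \<Longrightarrow> fst ` set w \<subseteq> S \<Longrightarrow> w \<in> ?gen" for w
  proof (induction w)
    case Nil
    then show ?case using generate.one[of "free_group S"] by (simp add: free_group_def)
  next
    case (Cons l w)
    have split: "l # w = [l] \<otimes>\<^bsub>free_group S\<^esub> w"
      using Cons.prems by (cases w) (auto simp: free_group_def reduced_Cons)
    have "[l] \<in> ?gen" "w \<in> ?gen"
      using Cons letter[of l] by (auto simp: reduced_Cons)
    then show ?case
      unfolding split by (rule generate.eng)
  qed
  then show "carrier (free_group S) \<subseteq> ?gen" by (auto simp: free_group_def)
  show "?gen \<subseteq> carrier (free_group S)"
    by (intro F.generate_incl) (auto intro: free_gen_closed)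
qed

definition presented_class :: "'a set \<Rightarrow> 'a letter list set \<Rightarrow> 'a letter list \<Rightarrow> 'a letter list set" where
  "presented_class S R w = normal_closure (free_group S) R #>\<^bsub>free_group S\<^esub> w"

context
  fixes S :: "'a set" and R :: "'a letter list set"
  assumes R: "R \<subseteq> carrier (free_group S)"
begin

interpretation F: group "free_group S" by (rule group_free_group)

interpretation N: normal "normal_closure (free_group S) R" "free_group S"
  by (rule F.normal_normal_closure[OF R])

lemma group_presented_group: "group (presented_group S R)"
  unfolding presented_group_def by (rule N.factorgroup_is_group)

lemma presented_class_hom: "presented_class S R \<in> hom (free_group S) (presented_group S R)"
  using N.r_coset_hom_Mod unfolding presented_class_def presented_group_def .

lemma presented_class_relator: "w \<in> R \<Longrightarrow> presented_class S R w = \<one>\<^bsub>presented_group S R\<^esub>"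
  using F.normal_closure_superset[of R]
  unfolding presented_class_def presented_group_def
  by (metis F.normal_closure_superset N.rcos_const F.is_group one_FactGroup subsetD)

lemma carrier_presented_group:
  "carrier (presented_group S R)
     = generate (presented_group S R) ((\<lambda>x. presented_class S R (free_gen x)) ` S)"
proof -
  interpret h: group_hom "free_group S" "presented_group S R" "presented_class S R"
    using F.is_group group_presented_group presented_class_hom
    by (simp add: group_hom_def group_hom_axioms_def)
  have "carrier (presented_group S R) = presented_class S R ` carrier (free_group S)"
    by (auto simp: presented_group_def presented_class_def FactGroup_def RCOSETS_def)
  also have "\<dots> = generate (presented_group S R) (presented_class S R ` free_gen ` S)"
    by (subst carrier_free_group, rule h.generate_img[symmetric]) (auto intro: free_gen_closed)
  finally show ?thesis by (simp add: image_image)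
qed

text \<open>
  The universal property of a presentation: the kernel of the evaluation of words is normal and
  contains the relators, hence their normal closure, so evaluation factors through the quotient.
\<close>

lemma presented_group_hom:
  assumes "group H" and v: "v \<in> S \<rightarrow> carrier H"
    and rel: "\<And>w. w \<in> R \<Longrightarrow> word_value H v w = \<one>\<^bsub>H\<^esub>"
  shows "\<exists>f \<in> hom (presented_group S R) H. \<forall>x \<in> S. f (presented_class S R (free_gen x)) = v x"
proof -
  interpret H: group H by fact
  interpret h: group_hom "free_group S" H "word_value H v"
    using F.is_group H.is_group H.word_value_hom[OF v]
    by (simp add: group_hom_def group_hom_axioms_def)
  have "R \<subseteq> kernel (free_group S) H (word_value H v)"
    using R rel by (auto simp: kernel_def)
  then have "normal_closure (free_group S) R \<subseteq> kernel (free_group S) H (word_value H v)"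
    unfolding normal_closure_def using h.normal_kernel by blast
  from h.FactGroup_universal_kernel[OF F.normal_normal_closure[OF R] this] obtain f where
    "f \<in> hom (free_group S Mod normal_closure (free_group S) R) H"
    "\<And>x. x \<in> carrier (free_group S)
       \<Longrightarrow> f (normal_closure (free_group S) R #>\<^bsub>free_group S\<^esub> x) = word_value H v x" by blast
  note f = this[folded presented_group_def presented_class_def]
  have "f (presented_class S R (free_gen x)) = v x" if "x \<in> S" for x
    using f(2)[OF free_gen_closed[OF that]] H.word_value_free_gen[of v x] funcset_mem[OF v that]
    by simp
  then show ?thesis using f(1) by blast
qed

end

section \<open>Metacyclic groups\<close>

definition metacyclic_relators :: "nat \<Rightarrow> nat \<Rightarrow> int \<Rightarrow> gen letter list set" where
  "metacyclic_relators m n r =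
     (let F = free_group {A, B}; a = free_gen A; b = free_gen B in
        {a [^]\<^bsub>F\<^esub> m,
         b [^]\<^bsub>F\<^esub> n,
         (inv\<^bsub>F\<^esub> a \<otimes>\<^bsub>F\<^esub> b \<otimes>\<^bsub>F\<^esub> a) \<otimes>\<^bsub>F\<^esub> inv\<^bsub>F\<^esub> (b [^]\<^bsub>F\<^esub> r)})"

lemma metacyclic_group_eq:
  "metacyclic_group m n r = presented_group {A, B} (metacyclic_relators m n r)"
  by (simp add: metacyclic_group_def metacyclic_relators_def Let_def)

lemma metacyclic_relators_closed: "metacyclic_relators m n r \<subseteq> carrier (free_group {A, B})"
proof -
  interpret F: group "free_group {A, B}" by (rule group_free_group)
  show ?thesis
    by (auto simp: metacyclic_relators_def Let_def free_gen_closed)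
qed

text \<open>
  The conjugation relation is stated as \<open>y x = x y^r\<close>, without inverses, which is the form in which it
  is verified in concrete groups and used to move powers of \<open>y\<close> past powers of \<open>x\<close>.
\<close>

definition metacyclic_relations ::
  "('a, 'b) monoid_scheme \<Rightarrow> nat \<Rightarrow> nat \<Rightarrow> int \<Rightarrow> 'a \<Rightarrow> 'a \<Rightarrow> bool" where
  "metacyclic_relations G m n r x y \<longleftrightarrow>
     x [^]\<^bsub>G\<^esub> m = \<one>\<^bsub>G\<^esub> \<and> y [^]\<^bsub>G\<^esub> n = \<one>\<^bsub>G\<^esub> \<and> y \<otimes>\<^bsub>G\<^esub> x = x \<otimes>\<^bsub>G\<^esub> y [^]\<^bsub>G\<^esub> r"

lemma metacyclic_relators_trivial_iff:
  assumes "group H" and f: "f \<in> hom (free_group {A, B}) H"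
  shows "(\<forall>w \<in> metacyclic_relators m n r. f w = \<one>\<^bsub>H\<^esub>)
     \<longleftrightarrow> metacyclic_relations H m n r (f (free_gen A)) (f (free_gen B))"
proof -
  interpret F: group "free_group {A, B}" by (rule group_free_group)
  interpret H: group H by fact
  interpret f: group_hom "free_group {A, B}" H f
    using F.is_group H.is_group f by (simp add: group_hom_def group_hom_axioms_def)
  have [simp]: "free_gen A \<in> carrier (free_group {A, B})" "free_gen B \<in> carrier (free_group {A, B})"
    by (simp_all add: free_gen_closed)
  define x y where "x = f (free_gen A)" and "y = f (free_gen B)"
  have xy: "x \<in> carrier H" "y \<in> carrier H" by (simp_all add: x_def y_def)
  have conj: "inv\<^bsub>H\<^esub> x \<otimes>\<^bsub>H\<^esub> y \<otimes>\<^bsub>H\<^esub> x \<otimes>\<^bsub>H\<^esub> inv\<^bsub>H\<^esub> (y [^]\<^bsub>H\<^esub> r) = \<one>\<^bsub>H\<^esub>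
      \<longleftrightarrow> y \<otimes>\<^bsub>H\<^esub> x = x \<otimes>\<^bsub>H\<^esub> y [^]\<^bsub>H\<^esub> r" (is "?l = \<one>\<^bsub>H\<^esub> \<longleftrightarrow> ?r")
  proof -
    have "?l = \<one>\<^bsub>H\<^esub> \<longleftrightarrow> inv\<^bsub>H\<^esub> x \<otimes>\<^bsub>H\<^esub> y \<otimes>\<^bsub>H\<^esub> x = y [^]\<^bsub>H\<^esub> r"
      using xy by (metis H.int_pow_closed H.inv_closed H.inv_equality H.inv_inv H.m_closed H.r_inv)
    also have "\<dots> \<longleftrightarrow> ?r"
      using xy by (metis H.int_pow_closed H.inv_closed H.inv_solve_left H.m_assoc H.m_closed)
    finally show ?thesis .
  qed
  show ?thesis
    using conj by (simp add: metacyclic_relators_def metacyclic_relations_def Let_def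
      f.hom_nat_pow f.hom_int_pow flip: x_def y_def)
qed

definition metacyclic_gen :: "nat \<Rightarrow> nat \<Rightarrow> int \<Rightarrow> gen \<Rightarrow> gen letter list set" where
  "metacyclic_gen m n r x = presented_class {A, B} (metacyclic_relators m n r) (free_gen x)"

lemma group_metacyclic_group: "group (metacyclic_group m n r)"
  unfolding metacyclic_group_eq by (intro group_presented_group metacyclic_relators_closed)

lemma metacyclic_gen_closed: "metacyclic_gen m n r x \<in> carrier (metacyclic_group m n r)"
  unfolding metacyclic_gen_def metacyclic_group_eq
  by (rule hom_in_carrier[OF presented_class_hom[OF metacyclic_relators_closed]])
     (cases x; simp add: free_gen_closed)

lemma metacyclic_gen_relations:
  "metacyclic_relations (metacyclic_group m n r) m n r
     (metacyclic_gen m n r A) (metacyclic_gen m n r B)"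
  unfolding metacyclic_gen_def metacyclic_group_eq
  using metacyclic_relators_trivial_iff[OF group_presented_group presented_class_hom]
    presented_class_relator metacyclic_relators_closed by metis

lemma carrier_metacyclic_group:
  "carrier (metacyclic_group m n r)
     = generate (metacyclic_group m n r) {metacyclic_gen m n r A, metacyclic_gen m n r B}"
  unfolding metacyclic_gen_def metacyclic_group_eq
  using carrier_presented_group[OF metacyclic_relators_closed] by simp

lemma metacyclic_group_hom:
  assumes "group H" and "x \<in> carrier H" "y \<in> carrier H" and "metacyclic_relations H m n r x y"
  shows "\<exists>f \<in> hom (metacyclic_group m n r) H.
    f (metacyclic_gen m n r A) = x \<and> f (metacyclic_gen m n r B) = y"
proof -
  interpret H: group H by fact
  define v where "v = case_gen x y"
  have v: "v \<in> {A, B} \<rightarrow> carrier H" using assms(2,3) by (simp add: v_def)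
  have "\<forall>w \<in> metacyclic_relators m n r. word_value H v w = \<one>\<^bsub>H\<^esub>"
    using metacyclic_relators_trivial_iff[OF assms(1) H.word_value_hom[OF v]] assms(2-)
    by (simp add: H.word_value_free_gen v_def)
  then show ?thesis
    using presented_group_hom[OF metacyclic_relators_closed assms(1) v]
    by (auto simp: metacyclic_group_eq metacyclic_gen_def v_def)
qed

section \<open>Semidirect products\<close>

lemma semidirect_product_simps:
  "carrier (semidirect_product X Y \<phi>) = carrier X \<times> carrier Y"
  "(x, y) \<otimes>\<^bsub>semidirect_product X Y \<phi>\<^esub> (x', y') = (x \<otimes>\<^bsub>X\<^esub> \<phi> y x', y \<otimes>\<^bsub>Y\<^esub> y')"
  "\<one>\<^bsub>semidirect_product X Y \<phi>\<^esub> = (\<one>\<^bsub>X\<^esub>, \<one>\<^bsub>Y\<^esub>)"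
  by (simp_all add: semidirect_product_def)

lemma AutoGroup_simps:
  "carrier (AutoGroup G) = auto G"
  "\<one>\<^bsub>AutoGroup G\<^esub> = (\<lambda>x \<in> carrier G. x)"
  "f \<in> auto G \<Longrightarrow> f' \<in> auto G \<Longrightarrow> f \<otimes>\<^bsub>AutoGroup G\<^esub> f' = compose (carrier G) f f'"
  by (simp_all add: AutoGroup_def BijGroup_def auto_def)

lemma group_semidirect_product:
  assumes "group X" "group Y" and \<phi>: "\<phi> \<in> hom Y (AutoGroup X)"
  shows "group (semidirect_product X Y \<phi>)"
proof -
  interpret X: group X by fact
  interpret Y: group Y by fact
  interpret Aut: group "AutoGroup X" by (rule X.AutoGroup)
  interpret \<phi>: group_hom Y "AutoGroup X" \<phi>
    using assms Aut.is_group by (simp add: group_hom_def group_hom_axioms_def)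
  have auto: "\<phi> y \<in> auto X" if "y \<in> carrier Y" for y
    using \<phi>.hom_closed[OF that] by (simp add: AutoGroup_simps)
  have closed: "\<phi> y x \<in> carrier X" if "y \<in> carrier Y" "x \<in> carrier X" for x y
    using auto[OF that(1)] that(2) by (auto simp: auto_def hom_def)
  have mult: "\<phi> y (x \<otimes>\<^bsub>X\<^esub> x') = \<phi> y x \<otimes>\<^bsub>X\<^esub> \<phi> y x'"
    if "y \<in> carrier Y" "x \<in> carrier X" "x' \<in> carrier X" for x x' y
    using auto[OF that(1)] that(2-) by (auto simp: auto_def hom_def)
  have comp: "\<phi> (y \<otimes>\<^bsub>Y\<^esub> y') x = \<phi> y (\<phi> y' x)"
    if "y \<in> carrier Y" "y' \<in> carrier Y" "x \<in> carrier X" for x y y'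
    using that by (simp add: AutoGroup_simps auto compose_def)
  have one: "\<phi> \<one>\<^bsub>Y\<^esub> x = x" if "x \<in> carrier X" for x
    using that by (simp add: AutoGroup_simps)
  show ?thesis
  proof (rule groupI)
    fix z assume "z \<in> carrier (semidirect_product X Y \<phi>)"
    then obtain x y where z: "z = (x, y)" "x \<in> carrier X" "y \<in> carrier Y"
      by (auto simp: semidirect_product_simps)
    have "(\<phi> (inv\<^bsub>Y\<^esub> y) (inv\<^bsub>X\<^esub> x), inv\<^bsub>Y\<^esub> y) \<otimes>\<^bsub>semidirect_product X Y \<phi>\<^esub> z
        = \<one>\<^bsub>semidirect_product X Y \<phi>\<^esub>"
    proof -
      have "\<phi> (inv\<^bsub>Y\<^esub> y) \<one>\<^bsub>X\<^esub> = \<one>\<^bsub>X\<^esub>"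
        using mult[of "inv\<^bsub>Y\<^esub> y" "\<one>\<^bsub>X\<^esub>" "\<one>\<^bsub>X\<^esub>"] closed[of "inv\<^bsub>Y\<^esub> y" "\<one>\<^bsub>X\<^esub>"] z
        by (simp del: \<phi>.hom_inv)
      then show ?thesis
        using z mult[of "inv\<^bsub>Y\<^esub> y" "inv\<^bsub>X\<^esub> x" x]
        by (simp add: semidirect_product_simps del: \<phi>.hom_inv)
    qed
    then show "\<exists>z' \<in> carrier (semidirect_product X Y \<phi>).
        z' \<otimes>\<^bsub>semidirect_product X Y \<phi>\<^esub> z = \<one>\<^bsub>semidirect_product X Y \<phi>\<^esub>"
      using z closed[of "inv\<^bsub>Y\<^esub> y" "inv\<^bsub>X\<^esub> x"]
      by (intro bexI[of _ "(\<phi> (inv\<^bsub>Y\<^esub> y) (inv\<^bsub>X\<^esub> x), inv\<^bsub>Y\<^esub> y)"])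
        (auto simp: semidirect_product_simps simp del: \<phi>.hom_inv)
  qed (auto simp: semidirect_product_simps closed mult comp one X.m_assoc Y.m_assoc
      simp del: \<phi>.hom_mult \<phi>.hom_one)
qed

definition mult_action :: "nat \<Rightarrow> int \<Rightarrow> int \<Rightarrow> int \<Rightarrow> int" where
  "mult_action n s y = (\<lambda>x \<in> carrier (integer_mod_group n). s ^ nat y * x mod int n)"

lemma cong_power_add_mod:
  fixes s y y' :: int
  assumes "[s ^ t = 1] (mod k)" "y \<ge> 0" "y' \<ge> 0"
  shows "[s ^ nat ((y + y') mod int t) = s ^ nat y * s ^ nat y'] (mod k)"
proof -
  have "nat y + nat y' = nat (y + y')"
    using assms(2,3) by (simp add: nat_add_distrib)
  also have "\<dots> = nat ((y + y') mod int t) + t * (nat (y + y') div t)"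
    using assms(2,3) by (simp add: nat_mod_distrib)
  finally have "s ^ nat y * s ^ nat y' = s ^ nat ((y + y') mod int t) * (s ^ t) ^ (nat (y + y') div t)"
    by (simp flip: power_add power_mult)
  moreover have "[(s ^ t) ^ (nat (y + y') div t) = 1] (mod k)"
    using cong_pow[OF assms(1), of "nat (y + y') div t"] by simp
  ultimately show ?thesis
    using cong_scalar_left[of _ 1 k "s ^ nat ((y + y') mod int t)"] by (simp add: cong_sym)
qed

text \<open>
  The hypothesis on \<open>s\<close> serves twice: it makes \<open>s\<close> a unit modulo \<open>n\<close>, so that the multiplications
  are bijective, and it makes the exponent of \<open>s\<close> depend only on its residue modulo \<open>t\<close>.
\<close>

lemma mult_action_hom:
  assumes "n > 0" and t: "t > 0" and s: "[s ^ t = 1] (mod int n)"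
  shows "mult_action n s \<in> hom (integer_mod_group t) (AutoGroup (integer_mod_group n))"
proof (rule homI)
  have "coprime s (int n)"
    using cong_imp_coprime[OF cong_sym[OF s]] \<open>t > 0\<close> by simp
  then have inj: "x = x'" if "s ^ k * x mod int n = s ^ k * x' mod int n" "x \<in> {0..<int n}" "x' \<in> {0..<int n}" for k x x'
  proof -
    have "[x = x'] (mod int n)"
      using that(1) cong_mult_lcancel[of "s ^ k" "int n" x x'] \<open>coprime s (int n)\<close>
      unfolding cong_def by simp
    then show ?thesis using that(2,3) by (simp add: cong_def)
  qed
  have carr: "carrier (integer_mod_group n) = {0..<int n}"
    using \<open>n > 0\<close> by (simp add: carrier_integer_mod_group)
  show auto: "mult_action n s y \<in> carrier (AutoGroup (integer_mod_group n))" for y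
  proof -
    have "inj_on (mult_action n s y) {0..<int n}"
      by (auto intro!: inj_onI inj[of "nat y"] simp: mult_action_def carr)
    moreover have "mult_action n s y ` {0..<int n} \<subseteq> {0..<int n}"
      using \<open>n > 0\<close> by (auto simp: mult_action_def carr)
    ultimately have "bij_betw (mult_action n s y) {0..<int n} {0..<int n}"
      by (simp add: bij_betw_def endo_inj_surj)
    moreover have "mult_action n s y \<in> hom (integer_mod_group n) (integer_mod_group n)"
      using \<open>n > 0\<close> by (auto intro!: homI simp: mult_action_def carr mod_simps ring_distribs)
    ultimately show ?thesis
      by (simp add: AutoGroup_simps auto_def Bij_def carr) (simp add: mult_action_def carr)
  qed
  fix y y' assume y: "y \<in> carrier (integer_mod_group t)" "y' \<in> carrier (integer_mod_group t)"
  have "[s ^ nat ((y + y') mod int t) = s ^ nat y * s ^ nat y'] (mod int n)"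
    using y t by (intro cong_power_add_mod s) (auto simp: carrier_integer_mod_group)
  then have "s ^ nat ((y + y') mod int t) * x mod int n = s ^ nat y * (s ^ nat y' * x) mod int n" for x
    by (metis cong_def cong_scalar_right mult.assoc)
  then show "mult_action n s (y \<otimes>\<^bsub>integer_mod_group t\<^esub> y')
      = mult_action n s y \<otimes>\<^bsub>AutoGroup (integer_mod_group n)\<^esub> mult_action n s y'"
    using auto[of y] auto[of y'] \<open>n > 0\<close>
    by (auto simp: AutoGroup_simps compose_def mult_action_def carr mod_simps fun_eq_iff)
qed

section \<open>Uniqueness of normal forms\<close>

text \<open>
  The relations alone only bound the size of the group from above.  That it does not collapse is seen in
  the semidirect product \<open>H\<close> of \<open>Z_n\<close> and \<open>Z_m\<close>, where \<open>(0, 1)\<close> and \<open>(1, 0)\<close> satisfy the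
  relations and have independent powers.
\<close>

lemma metacyclic_gen_independent:
  fixes i :: nat and j :: int
  assumes "m > 1" "n > 1" and r: "[r ^ m = 1] (mod int n)"
    and eq: "metacyclic_gen m n r A [^]\<^bsub>metacyclic_group m n r\<^esub> i
        \<otimes>\<^bsub>metacyclic_group m n r\<^esub> metacyclic_gen m n r B [^]\<^bsub>metacyclic_group m n r\<^esub> j
      = \<one>\<^bsub>metacyclic_group m n r\<^esub>"
  shows "m dvd i \<and> int n dvd j"
proof -
  interpret G: group "metacyclic_group m n r" by (rule group_metacyclic_group)
  \<comment> \<open>The relation \<open>b a = a b^r\<close> says that \<open>a\<close> acts on the powers of \<open>b\<close> from the left through
    the inverse of \<open>r\<close> modulo \<open>n\<close>.\<close>
  define s where "s = r ^ (m - 1)"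
  have sr: "[s * r = 1] (mod int n)"
    using r \<open>m > 1\<close> by (simp add: s_def flip: power_Suc2)
  have "[(r ^ m) ^ (m - 1) = 1] (mod int n)"
    using cong_pow[OF r, of "m - 1"] by simp
  then have sm: "[s ^ m = 1] (mod int n)"
    by (simp add: s_def mult.commute flip: power_mult)
  define X Y where "X = integer_mod_group n" and "Y = integer_mod_group m"
  define H where "H = semidirect_product X Y (mult_action n s)"
  have action: "mult_action n s \<in> hom Y (AutoGroup X)"
    using assms(1,2) sm unfolding X_def Y_def by (intro mult_action_hom) auto
  interpret H: group H
    unfolding H_def by (rule group_semidirect_product[OF _ _ action]) (simp_all add: X_def Y_def)
  have carr: "carrier X = {0..<int n}" "carrier Y = {0..<int m}"
    using assms(1,2) by (simp_all add: X_def Y_def carrier_integer_mod_group)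
  have mult: "(x, y) \<otimes>\<^bsub>H\<^esub> (x', y') = ((x + s ^ nat y * x') mod int n, (y + y') mod int m)"
    if "x' \<in> {0..<int n}" for x y x' y'
    using that by (simp add: H_def semidirect_product_simps mult_action_def X_def Y_def
      carr[unfolded X_def] mod_simps)
  have one: "\<one>\<^bsub>H\<^esub> = (0, 0)" by (simp add: H_def semidirect_product_simps X_def Y_def)
  interpret X: group_hom X H "\<lambda>x. (x, 0)"
    unfolding group_hom_def group_hom_axioms_def
  proof (intro conjI homI)
    show "group X" by (simp add: X_def)
    show "(x, 0) \<in> carrier H" if "x \<in> carrier X" for x
      using that assms(1) by (simp add: H_def semidirect_product_simps carr)
    show "(x \<otimes>\<^bsub>X\<^esub> x', 0) = (x, 0) \<otimes>\<^bsub>H\<^esub> (x', 0)" if "x \<in> carrier X" "x' \<in> carrier X" for x x'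
      using that by (simp add: mult carr) (simp add: X_def)
  qed (rule H.is_group)
  interpret Y: group_hom Y H "\<lambda>y. (0, y)"
    unfolding group_hom_def group_hom_axioms_def
  proof (intro conjI homI)
    show "group Y" by (simp add: Y_def)
    show "(0, y) \<in> carrier H" if "y \<in> carrier Y" for y
      using that assms(2) by (simp add: H_def semidirect_product_simps carr)
    show "(0, y \<otimes>\<^bsub>Y\<^esub> y') = (0, y) \<otimes>\<^bsub>H\<^esub> (0, y')" if "y \<in> carrier Y" "y' \<in> carrier Y" for y y'
      using that assms(2) by (simp add: mult carr) (simp add: Y_def)
  qed (rule H.is_group)
  have gens: "1 \<in> carrier X" "1 \<in> carrier Y"
    using assms(1,2) by (simp_all add: carr)
  have x_pow: "(0, 1) [^]\<^bsub>H\<^esub> k = (0, int k mod int m)" for k :: nat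
    using Y.hom_nat_pow[OF gens(2), of k] by (simp add: Y_def)
  have y_pow: "(1, 0) [^]\<^bsub>H\<^esub> k = (k mod int n, 0)" for k :: int
    using X.hom_int_pow[OF gens(1), of k] by (simp add: X_def int_pow_integer_mod_group)
  have "metacyclic_relations H m n r (0, 1) (1, 0)"
    unfolding metacyclic_relations_def
  proof (intro conjI)
    show "(0, 1) [^]\<^bsub>H\<^esub> m = \<one>\<^bsub>H\<^esub>" by (simp add: x_pow one)
    show "(1, 0) [^]\<^bsub>H\<^esub> n = \<one>\<^bsub>H\<^esub>" 
      using y_pow[of "int n"] by (simp add: one int_pow_int)
    show "(1, 0) \<otimes>\<^bsub>H\<^esub> (0, 1) = (0, 1) \<otimes>\<^bsub>H\<^esub> (1, 0) [^]\<^bsub>H\<^esub> r"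
      using assms(1,2) sr by (simp add: y_pow mult cong_def mod_simps)
  qed
  then obtain f where f: "f \<in> hom (metacyclic_group m n r) H"
    "f (metacyclic_gen m n r A) = (0, 1)" "f (metacyclic_gen m n r B) = (1, 0)"
    using metacyclic_group_hom[OF H.is_group Y.hom_closed[OF gens(2)] X.hom_closed[OF gens(1)]]
    by blast
  interpret f: group_hom "metacyclic_group m n r" H f
    using f(1) by unfold_locales
  have "\<one>\<^bsub>H\<^esub> = f \<one>\<^bsub>metacyclic_group m n r\<^esub>" by simp
  also have "\<dots> = (0, 1) [^]\<^bsub>H\<^esub> i \<otimes>\<^bsub>H\<^esub> (1, 0) [^]\<^bsub>H\<^esub> j"
    unfolding eq[symmetric]
    by (simp add: metacyclic_gen_closed f.hom_nat_pow f.hom_int_pow f(2,3))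
  also have "\<dots> = (s ^ nat (int i mod int m) * j mod int n, int i mod int m)"
    using assms(2) by (simp add: x_pow y_pow mult mod_simps)
  finally have eqs: "s ^ nat (int i mod int m) * j mod int n = 0 \<and> int i mod int m = 0"
    by (metis one prod.inject)
  then have i: "int i mod int m = 0" by (rule conjunct2)
  from eqs have "j mod int n = 0" unfolding i by simp
  with i show ?thesis by (simp add: mod_eq_0_iff_dvd)
qed

section \<open>Automorphisms of metacyclic groups\<close>

lemma (in group) conjugation_hom:
  assumes "g \<in> carrier G"
  shows "(\<lambda>x. inv g \<otimes> x \<otimes> g) \<in> hom G G"
proof (rule homI)
  fix x y assume xy: "x \<in> carrier G" "y \<in> carrier G"
  have "inv g \<otimes> x \<otimes> g \<otimes> (inv g \<otimes> y \<otimes> g) = inv g \<otimes> x \<otimes> (g \<otimes> inv g) \<otimes> (y \<otimes> g)"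
    using xy assms by (simp only: m_assoc m_closed inv_closed)
  then show "inv g \<otimes> (x \<otimes> y) \<otimes> g = inv g \<otimes> x \<otimes> g \<otimes> (inv g \<otimes> y \<otimes> g)"
    using xy assms by (simp add: m_assoc)
qed (use assms in simp)

lemma (in group) conjugation_int_pow:
  assumes "g \<in> carrier G" "x \<in> carrier G"
  shows "(inv g \<otimes> x \<otimes> g) [^] (k :: int) = inv g \<otimes> x [^] k \<otimes> g"
  using hom_int_pow[OF conjugation_hom[OF assms(1)] assms(2) is_group is_group] by simp

lemma (in group) commutation_int_pow:
  assumes "x \<in> carrier G" "y \<in> carrier G" "y \<otimes> x = x \<otimes> y [^] (k :: int)"
  shows "y [^] (j :: int) \<otimes> x = x \<otimes> y [^] (j * k)"
proof -
  have "inv x \<otimes> y \<otimes> x = y [^] k"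
    using assms by (simp add: m_assoc inv_solve_left')
  then have "inv x \<otimes> y [^] j \<otimes> x = y [^] (j * k)"
    using conjugation_int_pow[OF assms(1,2), of j] assms(1,2)
    by (simp add: int_pow_pow mult.commute)
  then show ?thesis
    using assms(1,2) by (metis int_pow_closed inv_solve_left m_assoc m_closed inv_closed)
qed

text \<open>
  What the proof needs about the presented group: the universal property for endomorphisms, that the
  exponents in \<open>a^i b^j\<close> are determined modulo \<open>m\<close> and \<open>n\<close>, and the arithmetic of \<open>m\<close>, \<open>n\<close>, \<open>r\<close>.
  The last assumption says that the action of \<open>a\<close> on the powers of \<open>b\<close> is faithful modulo \<open>m\<close>.
  Exponents of \<open>a\<close> are natural numbers, since they occur as exponents of \<open>r\<close> in \<open>b_pow_a_pow\<close>.
\<close>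

locale metacyclic = group G for G (structure) +
  fixes a b :: 'a and m n :: nat and r :: int
  assumes a_closed [simp]: "a \<in> carrier G" and b_closed [simp]: "b \<in> carrier G"
    and relations: "metacyclic_relations G m n r a b"
    and generated: "carrier G = generate G {a, b}"
    and endomorphism: "\<And>x y. x \<in> carrier G \<Longrightarrow> y \<in> carrier G \<Longrightarrow>
      metacyclic_relations G m n r x y \<Longrightarrow> \<exists>f \<in> hom G G. f a = x \<and> f b = y"
    and independent: "\<And>(i :: nat) (j :: int). a [^] i \<otimes> b [^] j = \<one> \<Longrightarrow> m dvd i \<and> int n dvd j"
    and m_pos: "m > 0" and n_pos: "n > 0"
    and coprime_m_n: "coprime m n"
    and coprime_r: "coprime (1 - r) (int n)"
    and power_r: "\<And>i j. [r ^ i = r ^ j] (mod int n) \<Longrightarrow> [i = j] (mod m)"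
begin

lemma a_pow_eq: 
  assumes "[i = j] (mod m)" shows "a [^] i = a [^] (j :: nat)"
proof -
  have "a [^] m = \<one>" using relations by (simp add: metacyclic_relations_def)
  then have "ord a dvd m" by (simp add: pow_eq_id)
  then have "[int i = int j] (mod int (ord a))"
    using assms by (simp add: cong_dvd_modulus_nat cong_int_iff)
  then have "a [^] int i = a [^] int j"
    by (simp add: int_pow_eq cong_iff_dvd_diff cong_sym_eq dvd_diff_commute)
  then show ?thesis by (simp add: int_pow_int)
qed

lemma b_pow_eq_iff: "b [^] (i :: int) = b [^] (j :: int) \<longleftrightarrow> [i = j] (mod int n)"
proof -
  have "b [^] k = \<one> \<longleftrightarrow> int n dvd k" for k :: int
  proof
    assume "b [^] k = \<one>"
    then show "int n dvd k" using independent[of 0 k] by simp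
  next
    assume "int n dvd k"
    moreover have "b [^] n = \<one>" using relations by (simp add: metacyclic_relations_def)
    then have "int (ord b) dvd int n" by (simp add: pow_eq_id)
    ultimately show "b [^] k = \<one>" using int_pow_eq_id[OF b_closed, of k] dvd_trans by blast
  qed
  then have "int (ord b) dvd k \<longleftrightarrow> int n dvd k" for k
    using int_pow_eq_id[OF b_closed] by blast
  then show ?thesis
    by (simp add: int_pow_eq cong_iff_dvd_diff dvd_diff_commute)
qed

lemma b_pow_a: "b [^] (j :: int) \<otimes> a = a \<otimes> b [^] (j * r)"
  using relations by (intro commutation_int_pow) (auto simp: metacyclic_relations_def)

lemma b_pow_a_pow: "b [^] (j :: int) \<otimes> a [^] (i :: nat) = a [^] i \<otimes> b [^] (j * r ^ i)"
proof (induction i)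
  case (Suc i)
  have "b [^] j \<otimes> a [^] Suc i = (b [^] j \<otimes> a [^] i) \<otimes> a" by (simp add: m_assoc)
  also have "\<dots> = a [^] i \<otimes> (b [^] (j * r ^ i) \<otimes> a)" by (simp add: Suc m_assoc)
  also have "\<dots> = a [^] Suc i \<otimes> b [^] (j * r ^ Suc i)"
    by (simp add: b_pow_a m_assoc mult_ac)
  finally show ?case .
qed simp

lemma normal_form:
  assumes "x \<in> carrier G"
  obtains i :: nat and j :: int where "x = a [^] i \<otimes> b [^] j"
proof -
  have "x \<in> generate G {a, b}" using assms generated by simp
  then have "\<exists>(i :: nat) (j :: int). x = a [^] i \<otimes> b [^] j"
  proof induction
    case one
    show ?case by (rule exI[of _ 0], rule exI[of _ 0]) simp
  next
    case (incl h)
    have "a = a [^] (1 :: nat) \<otimes> b [^] (0 :: int)" "b = a [^] (0 :: nat) \<otimes> b [^] (1 :: int)"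
      by simp_all
    with incl show ?case by blast
  next
    case (inv h)
    have "a [^] (m - 1) \<otimes> a = a [^] (0 :: nat)"
      using a_pow_eq[of m 0] m_pos by (metis Suc_diff_1 cong_0_iff dvd_refl nat_pow_Suc)
    then have "inv a = a [^] (m - 1) \<otimes> b [^] (0 :: int)"
      by (simp add: inv_equality)
    moreover have "inv b = a [^] (0 :: nat) \<otimes> b [^] (- 1 :: int)"
      by (simp add: int_pow_neg)
    ultimately show ?case using inv by blast
  next
    case (eng x y)
    then obtain i i' :: nat and j j' :: int
      where x: "x = a [^] i \<otimes> b [^] j" and y: "y = a [^] i' \<otimes> b [^] j'" by blast
    have "x \<otimes> y = a [^] i \<otimes> (b [^] j \<otimes> a [^] i') \<otimes> b [^] j'"
      by (simp add: x y m_assoc)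
    also have "\<dots> = a [^] (i + i') \<otimes> b [^] (j * r ^ i' + j')"
      by (simp add: b_pow_a_pow m_assoc int_pow_mult nat_pow_mult[symmetric])
    finally show ?case by blast
  qed
  then show ?thesis using that by blast
qed

lemma hom_eqI:
  assumes f: "f \<in> hom G G" and f': "f' \<in> hom G G"
    and "f a = f' a" "f b = f' b" and "x \<in> carrier G"
  shows "f x = f' x"
proof -
  interpret f: group_hom G G f using f by (simp add: group_hom_def group_hom_axioms_def)
  interpret f': group_hom G G f' using f' by (simp add: group_hom_def group_hom_axioms_def)
  obtain i :: nat and j :: int where "x = a [^] i \<otimes> b [^] j" using normal_form assms(5) .
  then show ?thesis
    using assms(3,4) by (simp add: f.hom_nat_pow f.hom_int_pow f'.hom_nat_pow f'.hom_int_pow)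
qed

text \<open>
  Conjugating \<open>a\<close> by \<open>b^d\<close> gives \<open>a b^((1 - r) d)\<close>.  As \<open>1 - r\<close> is a unit modulo \<open>n\<close>, every
  \<open>a b^c\<close> arises in this way and therefore satisfies \<open>x^m = 1\<close> just as \<open>a\<close> does.  This replaces the
  evaluation of the geometric sum in the exponent of \<open>b\<close> in \<open>(a b^c)^m\<close>.
\<close>

lemma affine_relations: "metacyclic_relations G m n r (a \<otimes> b [^] (c :: int)) (b [^] (u :: int))"
  unfolding metacyclic_relations_def
proof (intro conjI)
  obtain e where "[(1 - r) * e = 1] (mod int n)"
    using coprime_r cong_solve_coprime_int by blast
  then have "[(1 - r) * e * c = 1 * c] (mod int n)" by (rule cong_scalar_right)
  moreover define d where "d = e * c"
  ultimately have d: "[(1 - r) * d = c] (mod int n)" by (simp add: mult.assoc)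
  let ?g = "b [^] d"
  have "inv ?g \<otimes> a \<otimes> ?g = b [^] (- d) \<otimes> a \<otimes> b [^] d" by (simp add: int_pow_neg)
  also have "\<dots> = a \<otimes> b [^] (- d * r + d)" by (simp add: b_pow_a m_assoc flip: int_pow_mult)
  also have "b [^] (- d * r + d) = b [^] c"
    using d by (simp add: b_pow_eq_iff algebra_simps)
  finally have conj: "a \<otimes> b [^] c = inv ?g \<otimes> a \<otimes> ?g" by simp
  have "(a \<otimes> b [^] c) [^] int m = inv ?g \<otimes> a [^] int m \<otimes> ?g"
    unfolding conj by (simp add: conjugation_int_pow)
  also have "a [^] int m = \<one>"
    using relations by (simp add: metacyclic_relations_def int_pow_int)
  finally show "(a \<otimes> b [^] c) [^] m = \<one>" by (simp add: int_pow_int)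
  have "(b [^] u) [^] int n = b [^] (0 :: int)"
    unfolding int_pow_pow[OF b_closed] b_pow_eq_iff by (simp add: cong_0_iff)
  then show "(b [^] u) [^] n = \<one>" by (simp add: int_pow_int)
  show "b [^] u \<otimes> (a \<otimes> b [^] c) = a \<otimes> b [^] c \<otimes> (b [^] u) [^] r"
    by (simp add: m_assoc[symmetric] b_pow_a)
       (simp add: m_assoc int_pow_pow int_pow_mult[symmetric] add.commute)
qed

definition affine :: "int \<Rightarrow> int \<Rightarrow> ('a \<Rightarrow> 'a) \<Rightarrow> bool" where
  "affine c u f \<longleftrightarrow> f \<in> auto G \<and> f a = a \<otimes> b [^] c \<and> f b = b [^] u"

lemma affine_comp_generators:
  fixes c u c' u' :: int
  assumes f: "f \<in> hom G G" "f a = a \<otimes> b [^] c" "f b = b [^] u"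
    and f': "f' a = a \<otimes> b [^] c'" "f' b = b [^] u'"
  shows "f (f' a) = a \<otimes> b [^] (c + u * c')" "f (f' b) = b [^] (u * u')"
proof -
  interpret f: group_hom G G f using f by (simp add: group_hom_def group_hom_axioms_def)
  show "f (f' a) = a \<otimes> b [^] (c + u * c')" "f (f' b) = b [^] (u * u')"
    by (simp_all add: f(2-) f' f.hom_int_pow int_pow_pow int_pow_mult m_assoc)
qed

text \<open>
  Bijectivity needs no argument about sizes: the endomorphism with parameters \<open>(- v c, v)\<close>, where
  \<open>v\<close> is the inverse of \<open>u\<close>, is a two-sided inverse, as one sees on the generators.
\<close>

lemma affine_exists:
  assumes "coprime u (int n)"
  shows "\<exists>f. affine c u f"
proof -
  obtain v where uv: "[u * v = 1] (mod int n)"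
    using assms cong_solve_coprime_int by blast
  obtain f where f: "f \<in> hom G G" "f a = a \<otimes> b [^] c" "f b = b [^] u"
    using endomorphism[OF _ _ affine_relations[of c u]] by auto
  obtain f' where f': "f' \<in> hom G G" "f' a = a \<otimes> b [^] (- v * c)" "f' b = b [^] v"
    using endomorphism[OF _ _ affine_relations[of "- v * c" v]] by auto
  have id: "(\<lambda>x. x) \<in> hom G G" by (simp add: hom_def)
  have one: "a \<otimes> b [^] e = a" if "[e = 0] (mod int n)" for e
    using that b_pow_eq_iff[of e 0] by simp
  have "f (f' x) = x" if "x \<in> carrier G" for x
  proof (rule hom_eqI[OF _ id _ _ that])
    show "(\<lambda>x. f (f' x)) \<in> hom G G"
      using Group.hom_compose[OF f'(1) f(1)] by (simp add: comp_def)
    have "c + u * (- v * c) = (1 - u * v) * c" by (simp add: algebra_simps)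
    moreover have "int n dvd 1 - u * v"
      using uv by (simp add: cong_iff_dvd_diff dvd_diff_commute)
    ultimately have "[c + u * (- v * c) = 0] (mod int n)"
      by (simp add: cong_0_iff)
    then show "f (f' a) = a" 
      unfolding affine_comp_generators(1)[OF f f'(2,3)] by (rule one)
    show "f (f' b) = b"
      using affine_comp_generators(2)[OF f f'(2,3)] uv b_pow_eq_iff[of "u * v" 1] by simp
  qed
  moreover have "f' (f x) = x" if "x \<in> carrier G" for x
  proof (rule hom_eqI[OF _ id _ _ that])
    show "(\<lambda>x. f' (f x)) \<in> hom G G"
      using Group.hom_compose[OF f(1) f'(1)] by (simp add: comp_def)
    show "f' (f a) = a"
      unfolding affine_comp_generators(1)[OF f' f(2,3)] by (rule one) simp
    show "f' (f b) = b"
      using affine_comp_generators(2)[OF f' f(2,3)] uv b_pow_eq_iff[of "v * u" 1]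
      by (simp add: mult.commute)
  qed
  ultimately have "bij_betw f (carrier G) (carrier G)"
    using f(1) f'(1) by (intro bij_betw_byWitness[where f' = f']) (auto simp: hom_def)
  then have "bij_betw (restrict f (carrier G)) (carrier G) (carrier G)"
    by (subst bij_betw_cong[of _ _ f]) auto
  moreover have "restrict f (carrier G) \<in> hom G G"
    using f(1) by (auto simp: hom_def)
  ultimately have "affine c u (restrict f (carrier G))"
    using f by (simp add: affine_def auto_def Bij_def)
  then show ?thesis by blast
qed

lemma affine_unique:
  assumes "affine c u f" "affine c' u' f'" "[c = c'] (mod int n)" "[u = u'] (mod int n)"
  shows "f = f'"
proof (rule extensionalityI)
  show "f \<in> extensional (carrier G)" "f' \<in> extensional (carrier G)"
    using assms by (auto simp: affine_def auto_def Bij_def)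
  have powers: "b [^] c = b [^] c'" "b [^] u = b [^] u'"
    using assms(3,4) by (simp_all add: b_pow_eq_iff)
  show "f x = f' x" if "x \<in> carrier G" for x
    by (rule hom_eqI[OF _ _ _ _ that]) (use powers assms(1,2) in \<open>auto simp: affine_def auto_def\<close>)
qed

lemma affine_parameters:
  assumes "affine c u f" "affine c' u' f"
  shows "[c = c'] (mod int n)" "[u = u'] (mod int n)"
proof -
  have "a \<otimes> b [^] c = a \<otimes> b [^] c'" "b [^] u = b [^] u'"
    using assms by (simp_all add: affine_def)
  then show "[c = c'] (mod int n)" "[u = u'] (mod int n)"
    by (simp_all add: b_pow_eq_iff)
qed

lemma affine_mult:
  assumes "affine c u f" "affine c' u' f'"
  shows "affine (c + u * c') (u * u') (f \<otimes>\<^bsub>AutoGroup G\<^esub> f')"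
proof -
  interpret Aut: group "AutoGroup G" by (rule AutoGroup)
  have f: "f \<in> auto G" "f' \<in> auto G" using assms by (simp_all add: affine_def)
  then have "f \<otimes>\<^bsub>AutoGroup G\<^esub> f' \<in> auto G"
    using Aut.m_closed by (simp add: AutoGroup_simps(1))
  then show ?thesis
    using assms affine_comp_generators[of f c u f' c' u'] f
    by (simp add: affine_def AutoGroup_simps compose_def auto_def)
qed

text \<open>
  Modulo the powers of \<open>b\<close>, the equation \<open>b^n = 1\<close> shows that the exponent \<open>i\<close> of \<open>a\<close> in the
  image of \<open>b\<close> satisfies \<open>n i = 0\<close> modulo \<open>m\<close>, and \<open>n\<close> is coprime to \<open>m\<close>.
\<close>

lemma auto_b:
  assumes "f \<in> auto G"
  obtains u :: int where "f b = b [^] u"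
proof -
  interpret f: group_hom G G f
    using assms by (simp add: group_hom_def group_hom_axioms_def auto_def)
  obtain i :: nat and u :: int where fb: "f b = a [^] i \<otimes> b [^] u"
    using normal_form[OF f.hom_closed[OF b_closed]] .
  have pow: "\<exists>j :: int. (a [^] i \<otimes> b [^] u) [^] k = a [^] (i * k) \<otimes> b [^] j" for k :: nat
  proof (induction k)
    case 0
    show ?case by (rule exI[of _ 0]) simp
  next
    case (Suc k)
    then obtain j :: int where "(a [^] i \<otimes> b [^] u) [^] k = a [^] (i * k) \<otimes> b [^] j" ..
    then have "(a [^] i \<otimes> b [^] u) [^] Suc k = a [^] (i * k) \<otimes> (b [^] j \<otimes> a [^] i) \<otimes> b [^] u"
      by (simp add: m_assoc)
    also have "\<dots> = (a [^] (i * k) \<otimes> a [^] i) \<otimes> (b [^] (j * r ^ i) \<otimes> b [^] u)"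
      by (simp add: b_pow_a_pow m_assoc)
    also have "\<dots> = a [^] (i * Suc k) \<otimes> b [^] (j * r ^ i + u)"
      by (simp add: nat_pow_mult int_pow_mult add.commute[of "i * k"])
    finally show ?case by blast
  qed
  have "f b [^] n = f (b [^] n)" by (simp add: f.hom_nat_pow)
  also have "\<dots> = \<one>" using relations by (simp add: metacyclic_relations_def)
  finally obtain j :: int where "a [^] (i * n) \<otimes> b [^] j = \<one>"
    using pow[of n] fb by metis
  then have "m dvd i * n" using independent by blast
  then have "m dvd i" using coprime_m_n by (simp add: coprime_dvd_mult_left_iff)
  then have "f b = b [^] u" using a_pow_eq[of i 0] fb by (simp add: cong_0_iff)
  then show ?thesis by (rule that)
qed

lemma auto_affine:
  assumes f: "f \<in> auto G"
  obtains c u where "coprime u (int n)" "affine c u f"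
proof -
  interpret Aut: group "AutoGroup G" by (rule AutoGroup)
  interpret f: group_hom G G f
    using assms by (simp add: group_hom_def group_hom_axioms_def auto_def)
  obtain u :: int where u: "f b = b [^] u" using auto_b[OF f] .
  \<comment> \<open>The inverse automorphism also sends \<open>b\<close> to a power of itself, so \<open>u\<close> is invertible.\<close>
  define f' where "f' = inv\<^bsub>AutoGroup G\<^esub> f"
  have f': "f' \<in> auto G"
    using f Aut.inv_closed[of f] by (simp add: f'_def AutoGroup_simps)
  then obtain v :: int where v: "f' b = b [^] v" using auto_b by blast
  have "f \<otimes>\<^bsub>AutoGroup G\<^esub> f' = \<one>\<^bsub>AutoGroup G\<^esub>"
    using f by (simp add: f'_def AutoGroup_simps(1))
  then have "f (f' b) = b"
    using f f' by (metis AutoGroup_simps(2,3) b_closed compose_eq restrict_apply')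
  then have "b [^] (u * v) = b [^] (1 :: int)"
    by (simp add: u v f.hom_int_pow int_pow_pow)
  then have "[u * v = 1] (mod int n)" by (simp only: b_pow_eq_iff)
  then have coprime_u: "coprime u (int n)"
    using coprime_iff_invertible_int by blast
  obtain i :: nat and c :: int where fa: "f a = a [^] i \<otimes> b [^] c"
    using normal_form[OF f.hom_closed[OF a_closed]] .
  \<comment> \<open>Comparing exponents in the image of \<open>b a = a b^r\<close> forces \<open>r^i = r\<close> modulo \<open>n\<close>.\<close>
  have "f b \<otimes> f a = f (b \<otimes> a)" by simp
  also have "b \<otimes> a = a \<otimes> b [^] r" using relations by (simp add: metacyclic_relations_def)
  also have "f \<dots> = f a \<otimes> f b [^] r" by (simp add: f.hom_int_pow)
  finally have "b [^] u \<otimes> (a [^] i \<otimes> b [^] c) = a [^] i \<otimes> b [^] c \<otimes> b [^] (u * r)"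
    by (simp add: u fa int_pow_pow)
  moreover have "b [^] u \<otimes> (a [^] i \<otimes> b [^] c) = a [^] i \<otimes> b [^] (u * r ^ i + c)"
    by (simp add: m_assoc[symmetric] b_pow_a_pow) (simp add: m_assoc int_pow_mult)
  moreover have "a [^] i \<otimes> b [^] c \<otimes> b [^] (u * r) = a [^] i \<otimes> b [^] (u * r + c)"
    by (simp add: m_assoc int_pow_mult[symmetric] add.commute)
  ultimately have "b [^] (u * r ^ i + c) = b [^] (u * r + c)"
    by simp
  then have "[u * r ^ i = u * r ^ 1] (mod int n)"
    by (simp add: b_pow_eq_iff cong_add_rcancel)
  then have "[r ^ i = r ^ 1] (mod int n)"
    using coprime_u by (simp only: cong_mult_lcancel)
  then have "f a = a \<otimes> b [^] c"
    using power_r a_pow_eq[of i 1] fa by simp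
  then show ?thesis
    using that coprime_u f u by (simp add: affine_def)
qed

text \<open>
  The powers of \<open>g\<close> below \<open>g^t\<close> enumerate the units modulo \<open>n\<close>, so the pairs \<open>(x, y)\<close> enumerate the
  affine parameters \<open>(x, g^y)\<close>, and by \<open>affine_mult\<close> they multiply in the same way.
\<close>

theorem AutoGroup_iso:
  fixes g t :: nat
  assumes t: "t > 0" and gt: "[g ^ t = 1] (mod n)"
    and gen: "bij_betw (\<lambda>k. g ^ k mod n) {..<t} (totatives n)"
  shows "AutoGroup G \<cong> semidirect_product (integer_mod_group n) (integer_mod_group t) (mult_action n (int g))"
    (is "_ \<cong> ?S")
proof -
  have gt': "[int g ^ t = 1] (mod int n)"
    using gt by (metis cong_int_iff of_nat_1 of_nat_power)
  interpret S: group ?S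
    using mult_action_hom[OF n_pos t gt'] by (intro group_semidirect_product) auto
  have carr: "carrier ?S = {0..<int n} \<times> {0..<int t}"
    using n_pos t by (simp add: semidirect_product_simps carrier_integer_mod_group)
  have g: "coprime (int g ^ k) (int n)" for k
    using cong_imp_coprime[OF cong_sym[OF gt']] t by simp
  define \<Psi> where "\<Psi> = (\<lambda>(x, y). SOME f. affine x (int g ^ nat y) f)"
  have \<Psi>: "affine x (int g ^ nat y) (\<Psi> (x, y))" for x y
    unfolding \<Psi>_def using someI_ex[OF affine_exists[OF g]] by simp
  have "\<Psi> \<in> iso ?S (AutoGroup G)"
    unfolding iso_def
  proof (intro CollectI conjI homI)
    fix z assume "z \<in> carrier ?S"
    show "\<Psi> z \<in> carrier (AutoGroup G)"
      using \<Psi> by (cases z) (simp add: affine_def AutoGroup_simps)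
  next
    fix z z' assume "z \<in> carrier ?S" "z' \<in> carrier ?S"
    then obtain x y x' y' where z: "z = (x, y)" "z' = (x', y')"
      and xy: "x \<in> {0..<int n}" "x' \<in> {0..<int n}" "y \<in> {0..<int t}" "y' \<in> {0..<int t}"
      unfolding carr by blast
    have pow: "[int g ^ nat ((y + y') mod int t) = int g ^ nat y * int g ^ nat y'] (mod int n)"
      using xy by (intro cong_power_add_mod gt') auto
    have "z \<otimes>\<^bsub>?S\<^esub> z' = ((x + int g ^ nat y * x' mod int n) mod int n, (y + y') mod int t)"
      using xy n_pos by (simp add: z semidirect_product_simps mult_action_def carrier_integer_mod_group)
    then have "affine ((x + int g ^ nat y * x' mod int n) mod int n)
        (int g ^ nat ((y + y') mod int t)) (\<Psi> (z \<otimes>\<^bsub>?S\<^esub> z'))"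
      using \<Psi> by simp
    moreover have "affine (x + int g ^ nat y * x') (int g ^ nat y * int g ^ nat y')
        (\<Psi> z \<otimes>\<^bsub>AutoGroup G\<^esub> \<Psi> z')"
      unfolding z by (intro affine_mult \<Psi>)
    ultimately show "\<Psi> (z \<otimes>\<^bsub>?S\<^esub> z') = \<Psi> z \<otimes>\<^bsub>AutoGroup G\<^esub> \<Psi> z'"
      by (rule affine_unique) (simp_all add: pow cong_def[of "_ mod int n"] mod_simps)
  next
    show "bij_betw \<Psi> (carrier ?S) (carrier (AutoGroup G))"
      unfolding bij_betw_def
    proof
      show "inj_on \<Psi> (carrier ?S)"
      proof (rule inj_onI)
        fix z z' assume zz: "z \<in> carrier ?S" "z' \<in> carrier ?S" "\<Psi> z = \<Psi> z'"
        then obtain x y x' y' where z: "z = (x, y)" "z' = (x', y')"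
          and xy: "x \<in> {0..<int n}" "x' \<in> {0..<int n}" "y \<in> {0..<int t}" "y' \<in> {0..<int t}"
          unfolding carr by blast
        have "affine x (int g ^ nat y) (\<Psi> z)" "affine x' (int g ^ nat y') (\<Psi> z)"
          using \<Psi>[of x y] \<Psi>[of x' y'] zz(3) by (simp_all add: z)
        note affine_parameters[OF this]
        then have "x = x'" "[g ^ nat y = g ^ nat y'] (mod n)"
          using xy by (auto simp: cong_less_imp_eq_int simp flip: cong_int_iff)
        moreover from this have "nat y = nat y'"
          using xy inj_onD[OF bij_betw_imp_inj_on[OF gen], of "nat y" "nat y'"]
          by (auto simp: cong_def)
        ultimately show "z = z'" using xy by (auto simp: z eq_nat_nat_iff)
      qed
      show "\<Psi> ` carrier ?S = carrier (AutoGroup G)"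
      proof (intro equalityI subsetI)
        fix f assume "f \<in> \<Psi> ` carrier ?S"
        then show "f \<in> carrier (AutoGroup G)"
          using \<Psi> by (auto simp: affine_def AutoGroup_simps)
      next
        fix f assume "f \<in> carrier (AutoGroup G)"
        then have "f \<in> auto G" by (simp add: AutoGroup_simps)
        from auto_affine[OF this] obtain c u
          where u: "coprime u (int n)" and f: "affine c u f" .
        obtain k where k: "k < t" "[u = int g ^ k] (mod int n)"
        proof -
          define w where "w = nat (u mod int n)"
          have w: "int w = u mod int n" using n_pos by (simp add: w_def)
          then have "coprime w n"
            using u n_pos by (simp flip: coprime_int_iff)
          moreover have "w < n" using n_pos by (simp add: w_def nat_less_iff)
          \<comment> \<open>This excludes \<open>n = 1\<close>, where the residue 0 is a unit but not a member of \<open>totatives n\<close>.\<close>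
          moreover have "g ^ 0 mod n \<in> totatives n"
            using bij_betwE[OF gen] t by blast
          then have "n \<noteq> 1" by (auto simp: totatives_def)
          ultimately have "w \<in> totatives n"
            by (cases "w = 0") (auto simp: totatives_def)
          then obtain k where k: "k < t" "w = g ^ k mod n"
            using bij_betw_imp_surj_on[OF gen] by blast
          then have "[u = int g ^ k] (mod int n)"
            using w by (simp add: cong_def zmod_int)
          with k(1) show ?thesis by (rule that)
        qed
        have "f = \<Psi> (c mod int n, int k)"
          using f \<Psi>[of "c mod int n" "int k"] by (rule affine_unique) (use k in simp_all)
        then show "f \<in> \<Psi> ` carrier ?S"
          using k n_pos by (auto simp: carr)
      qed
    qed
  qed
  then show ?thesis
    using S.iso_sym by (auto simp: is_iso_def)
qed

end

section \<open>Orders modulo squares of primes\<close>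

text \<open>
  An integer has the same powers modulo \<open>n\<close> as its least nonnegative residue, so the facts about orders
  of natural numbers carry over.
\<close>

lemma ord_int_cong:
  assumes "n > 0"
  shows "[r ^ i = r ^ j] (mod int n) \<Longrightarrow> coprime r (int n) \<Longrightarrow> [i = j] (mod ord (int n) r)"
    and "[r ^ ord (int n) r = 1] (mod int n)"
proof -
  define s where "s = nat (r mod int n)"
  have s: "int s = r mod int n" using assms by (simp add: s_def)
  have pow: "[r ^ k = int (s ^ k)] (mod int n)" for k
    by (simp add: s cong_def power_mod)
  then have pow1: "[r ^ k = 1] (mod int n) \<longleftrightarrow> [s ^ k = 1] (mod n)" for k
    by (metis cong_int_iff cong_sym cong_trans of_nat_1)
  have coprime: "coprime (int n) r \<longleftrightarrow> coprime n s"
    using assms by (simp add: s coprime_commute flip: coprime_int_iff)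
  have ord_eq: "ord (int n) r = ord n s"
    by (simp add: ord_def pow1 coprime)
  show "[r ^ ord (int n) r = 1] (mod int n)"
    unfolding ord_eq pow1 by (rule ord)
  show "[i = j] (mod ord (int n) r)" if "[r ^ i = r ^ j] (mod int n)" "coprime r (int n)"
  proof -
    have "[s ^ i = s ^ j] (mod n)"
      using that(1) pow by (metis cong_int_iff cong_sym cong_trans)
    then show ?thesis
      using that(2) coprime by (simp add: ord_eq order_divides_expdiff coprime_commute)
  qed
qed

text \<open>
  In \<open>r^p - 1 = (r - 1) (1 + r + \<dots> + r^(p - 1))\<close> both factors are divisible by \<open>p\<close>: the second one
  is a sum of \<open>p\<close> terms congruent to 1.
\<close>

lemma power_prime_cong_1:
  fixes r :: int
  assumes "[r = 1] (mod int p)"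
  shows "[r ^ p = 1] (mod int p ^ 2)"
proof -
  have "[(\<Sum>i<p. r ^ i) = (\<Sum>i<p. 1 ^ i)] (mod int p)"
    using assms by (intro cong_sum cong_pow)
  then have "int p dvd (\<Sum>i<p. r ^ i)"
    by (simp add: cong_def mod_eq_0_iff_dvd)
  moreover have "int p dvd r - 1" using assms by (simp add: cong_iff_dvd_diff)
  ultimately have "int p ^ 2 dvd r ^ p - 1"
    unfolding power2_eq_square power_diff_1_eq by (intro mult_dvd_mono)
  then show ?thesis by (simp add: cong_iff_dvd_diff)
qed

section \<open>The automorphism group\<close>

theorem mainTheorem3:
  fixes p q :: nat and r :: int
  assumes "prime p" and "prime q" and "p \<noteq> q" and "p * q \<noteq> 6"
    and "q ^ 2 dvd p - 1"
    and "ord (int p ^ 2) r = q ^ 2"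
  shows "\<exists>\<phi> \<in> hom (integer_mod_group (p * (p - 1))) (AutoGroup (integer_mod_group (p ^ 2))).
           AutoGroup (metacyclic_group (q ^ 2) (p ^ 2) r)
             \<cong> semidirect_product (integer_mod_group (p ^ 2)) (integer_mod_group (p * (p - 1))) \<phi>"
proof -
  define m n where "m = q ^ 2" and "n = p ^ 2"
  have p: "p > 1" and q: "q > 1" using assms(1,2) by (auto dest: prime_gt_1_nat)
  have m: "m > 1" and n: "n > 1" using p q by (simp_all only: m_def n_def one_less_power zero_less_numeral)
  have ord_r: "ord (int n) r = m" using assms(6) by (simp add: m_def n_def)
  have rm: "[r ^ m = 1] (mod int n)"
    using ord_int_cong(2)[of n r] n by (simp add: ord_r)
  then have r: "coprime r (int n)"
    using cong_imp_coprime[OF cong_sym[OF rm]] m by simp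
  have power_r: "[i = j] (mod m)" if "[r ^ i = r ^ j] (mod int n)" for i j
    using ord_int_cong(1)[OF _ that r] n by (simp add: ord_r)
  have "\<not> q dvd p"
    using assms(1-3) primes_dvd_imp_eq by blast
  have coprime_mn: "coprime m n"
    using assms(1-3) by (simp add: m_def n_def primes_coprime)
  have "\<not> int p dvd 1 - r"
  proof
    assume "int p dvd 1 - r"
    then have "[r ^ p = r ^ 0] (mod int n)"
      using power_prime_cong_1[of r p] by (simp add: n_def cong_iff_dvd_diff dvd_diff_commute)
    then have "m dvd p" using power_r[of p 0] by (simp add: cong_0_iff)
    then show False using \<open>\<not> q dvd p\<close> by (auto simp: m_def power2_eq_square dest: dvd_mult_left)
  qed
  then have coprime_r: "coprime (1 - r) (int n)"
    using assms(1) by (simp add: n_def prime_imp_coprime coprime_commute[of "1 - r"])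
  have "odd p"
  proof
    assume "even p"
    then have "p = 2" using assms(1) prime_prime_factor two_is_prime_nat primes_dvd_imp_eq by metis
    then show False using assms(5) q by simp
  qed
  then have "n \<in> cyclic_moduli"
    using assms(1) unfolding cyclic_moduli_def n_def by (blast intro: zero_less_numeral)
  then obtain g where g: "residue_primroot n g"
    using residue_primroot_iff_in_cyclic_moduli by blast
  have t: "totient n = p * (p - 1)"
    using totient_prime_power[OF assms(1), of 2] by (simp add: n_def)
  have t_pos: "p * (p - 1) > 0" using p by simp
  have gt: "[g ^ (p * (p - 1)) = 1] (mod n)"
    using g ord[of g n] by (simp add: residue_primroot_def t)
  define G where "G = metacyclic_group m n r"
  interpret G: group G unfolding G_def by (rule group_metacyclic_group)
  interpret metacyclic G "metacyclic_gen m n r A" "metacyclic_gen m n r B" m n r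
  proof
    show "\<exists>f \<in> hom G G. f (metacyclic_gen m n r A) = x \<and> f (metacyclic_gen m n r B) = y"
      if "x \<in> carrier G" "y \<in> carrier G" "metacyclic_relations G m n r x y" for x y
      using metacyclic_group_hom[OF G.is_group that] unfolding G_def .
    show "m dvd i \<and> int n dvd j"
      if "metacyclic_gen m n r A [^]\<^bsub>G\<^esub> i \<otimes>\<^bsub>G\<^esub> metacyclic_gen m n r B [^]\<^bsub>G\<^esub> j = \<one>\<^bsub>G\<^esub>"
      for i :: nat and j :: int
      using metacyclic_gen_independent[OF m n rm that[unfolded G_def]] .
  qed (use m n coprime_mn coprime_r power_r metacyclic_gen_closed metacyclic_gen_relations
      carrier_metacyclic_group in \<open>auto simp: G_def\<close>)
  have "AutoGroup G \<cong> semidirect_product (integer_mod_group n)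
      (integer_mod_group (p * (p - 1))) (mult_action n (int g))"
    using AutoGroup_iso[OF t_pos gt] residue_primroot_is_generator[OF n g] by (simp add: t)
  moreover have "mult_action n (int g)
      \<in> hom (integer_mod_group (p * (p - 1))) (AutoGroup (integer_mod_group n))"
    using gt n t_pos by (intro mult_action_hom) (simp_all flip: cong_int_iff)
  ultimately show ?thesis unfolding G_def m_def n_def by blast
qed

end
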